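(* Let $\theta\in[0,1]$, $\eta\in[0,1)$ and let $\delta>0$ be a constant with $2\delta+\eta<1$. For each even positive integer $M$, let $\mathcal M$ be a set of cardinality $M$ and let $\psi:\mathcal M\to\mathcal M$ be an involutive permutation ($\psi\circ\psi=\mathrm{Id}$) whose set of fixed points $\mathscr F_\psi=\{y\in\mathcal M:\psi(y)=y\}$ satisfies $|\mathscr F_\psi|=\theta M\left(1+O(M^{\eta-1})\right)$ as $M\to\infty$. Let $k$ be a non-negative integer. Then, as $M\to\infty$: 1. If $k$ is odd, $$\frac{1}{|\mathcal X_\psi|}\left|\left\{\mathbf x\in\mathcal X_\psi:\ \left|\frac{m_k(\mathbf x)}{M}-\frac{1-\theta}{e\,k!}\right|<M^{-\delta}\right\}\right|\ \ge\ 1-O\left(M^{2\delta+\eta-1}+k^2M^{2\delta-1}\right).$$ 2. If $k$ is even, $$\frac{1}{|\mathcal X_\psi|}\left|\left\{\mathbf x\in\mathcal X_\psi:\ \left|\frac{m_k(\mathbf x)}{M}-\frac{1-\theta}{e\,k!}-\frac{\theta}{e^{1/2}\,2^{k/2}(k/2)!}\right|<M^{-\delta}\right\}\right|\ \ge\ 1-O\left(M^{2\delta+\eta-1}+k^2M^{2\delta-1}\right).$$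
   Context: For a finite set $\mathcal M$ of even cardinality $M$ and an involutive permutation $\psi$ of $\mathcal M$, $\mathcal X_\psi=\{\mathbf x=(x_1,\dots,x_M)\in\mathcal M^M:\ x_{M+1-j}=\psi(x_j)\text{ for all }j=1,\dots,M\}$ (so $|\mathcal X_\psi|=M^{M/2}$). For $\mathbf x\in\mathcal X_\psi$ and an integer $k\ge0$, $m_k(\mathbf x)$ denotes the number of $y\in\mathcal M$ that occur exactly $k$ times among the components $x_1,\dots,x_M$ of $\mathbf x$. *)

theory Defs
  imports Complex_Main "HOL-Library.FuncSet" "HOL-Library.Landau_Symbols"
begin

definition X_psi :: "'a set \<Rightarrow> ('a \<Rightarrow> 'a) \<Rightarrow> (nat \<Rightarrow> 'a) set" where
  "X_psi A \<psi> = {x \<in> {1..card A} \<rightarrow>\<^sub>E A. \<forall>j\<in>{1..card A}. x (card A + 1 - j) = \<psi> (x j)}"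

definition occ_count :: "'a set \<Rightarrow> nat \<Rightarrow> (nat \<Rightarrow> 'a) \<Rightarrow> nat" where
  "occ_count A k x = card {y \<in> A. card {j \<in> {1..card A}. x j = y} = k}"

definition fixed_points :: "'a set \<Rightarrow> ('a \<Rightarrow> 'a) \<Rightarrow> 'a set" where
  "fixed_points A \<psi> = {y \<in> A. \<psi> y = y}"

end

theory Submission
  imports Defs
begin

text \<open>
  Restriction to the first \<open>n = M/2\<close> coordinates identifies \<open>X_psi\<close> with \<open>A\<^sup>n\<close>, that is, with \<open>n\<close>
  independent uniform draws from \<open>A\<close>. A point \<open>y\<close> then occurs \<open>2 Bin(n, 1/M)\<close> times if
  \<open>\<psi> y = y\<close>, and \<open>Bin(n, 2/M)\<close> times otherwise. Both laws are within \<open>4/M\<close> of their Poisson limits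
  (parameters \<open>1/2\<close> and \<open>1\<close>), uniformly in \<open>k\<close>: adding one trial and advancing the Poisson
  parameter by \<open>p\<close> agree up to \<open>2 p\<^sup>2\<close>, by Taylor's theorem. This gives the mean of \<open>m\<^sub>k\<close>. Redrawing one
  coordinate affects the multiplicities of at most four points, so the variance of \<open>m\<^sub>k\<close> is at most
  \<open>16 n\<close>, and Chebyshev's inequality concludes.
\<close>

section \<open>Averages and variances over finite product spaces\<close>

lemma sum_PiE_insert:
  assumes "i \<notin> I"
  shows "(\<Sum>x\<in>insert i I \<rightarrow>\<^sub>E A. f x) = (\<Sum>a\<in>A. \<Sum>x\<in>I \<rightarrow>\<^sub>E A. f (x(i := a)))"
proof -
  have "(\<Sum>x\<in>insert i I \<rightarrow>\<^sub>E A. f x) = (\<Sum>(a, x)\<in>A \<times> (I \<rightarrow>\<^sub>E A). f (x(i := a)))"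
    unfolding PiE_insert_eq
    by (subst sum.reindex[OF inj_combinator[OF assms]]) (simp add: case_prod_unfold o_def)
  then show ?thesis by (simp add: sum.cartesian_product)
qed

text \<open>The cross term vanishes because deviations from the mean sum to zero. The identity
  serves twice: coordinate by coordinate in the variance bound, and later to split the second moment
  about a target into variance and squared bias.\<close>

lemma sum_square_deviation:
  fixes h :: "'a \<Rightarrow> real" and m :: real
  assumes "finite A" "A \<noteq> {}"
  defines "m \<equiv> (\<Sum>a\<in>A. h a) / card A"
  shows "(\<Sum>a\<in>A. (h a - u)\<^sup>2) = (\<Sum>a\<in>A. (h a - m)\<^sup>2) + card A * (m - u)\<^sup>2"
proof -
  have s: "(\<Sum>a\<in>A. h a) = card A * m"
    using assms by (simp add: m_def)
  have "(\<Sum>a\<in>A. (h a - u)\<^sup>2) = (\<Sum>a\<in>A. (h a - m)\<^sup>2 + (2 * (m - u) * h a + (u\<^sup>2 - m\<^sup>2)))"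
    by (intro sum.cong refl) (simp add: power2_eq_square algebra_simps)
  also have "\<dots> = (\<Sum>a\<in>A. (h a - m)\<^sup>2) + (2 * (m - u) * (card A * m) + card A * (u\<^sup>2 - m\<^sup>2))"
    by (simp add: sum.distrib sum_distrib_left[symmetric] s)
  also have "2 * (m - u) * (card A * m) + card A * (u\<^sup>2 - m\<^sup>2) = card A * (m - u)\<^sup>2"
    by (simp add: power2_eq_square algebra_simps)
  finally show ?thesis .
qed

lemma abs_average_diff_le:
  fixes h :: "'a \<Rightarrow> real"
  assumes "finite A" "A \<noteq> {}" "\<And>a. a \<in> A \<Longrightarrow> \<bar>h a - u\<bar> \<le> c"
  shows "\<bar>(\<Sum>a\<in>A. h a) / card A - u\<bar> \<le> c"
proof -
  have pos: "real (card A) > 0" using assms by (simp add: card_gt_0_iff)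
  have "\<bar>\<Sum>a\<in>A. h a - u\<bar> \<le> (\<Sum>a\<in>A. c)"
    using assms(3) by (intro order.trans[OF sum_abs] sum_mono) auto
  then have "\<bar>(\<Sum>a\<in>A. h a) - card A * u\<bar> \<le> card A * c"
    by (simp add: sum_subtractf)
  moreover have "(\<Sum>a\<in>A. h a) / card A - u = ((\<Sum>a\<in>A. h a) - card A * u) / card A"
    using pos by (simp add: field_simps)
  ultimately show ?thesis
    using pos by (simp add: divide_le_eq mult.commute)
qed

text \<open>Induction on the coordinates. Averaging out coordinate \<open>i\<close> gives
  \<open>g\<close>, which keeps the mean of \<open>f\<close> and inherits its bounded differences.
  On each fibre the square deviation of \<open>f\<close> splits into the fluctuation about
  \<open>g\<close>, at most \<open>c\<close> in absolute value, and the deviation of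
  \<open>g\<close>, so every coordinate adds at most the square of \<open>c\<close> to the
  variance.\<close>

lemma bounded_differences_variance:
  fixes f :: "('i \<Rightarrow> 'a) \<Rightarrow> real" and c :: real
  assumes "finite I" "finite A" "A \<noteq> {}"
    and "\<And>x i a. x \<in> I \<rightarrow>\<^sub>E A \<Longrightarrow> i \<in> I \<Longrightarrow> a \<in> A \<Longrightarrow> \<bar>f (x(i := a)) - f x\<bar> \<le> c"
  shows "(\<Sum>x\<in>I \<rightarrow>\<^sub>E A. (f x - (\<Sum>x\<in>I \<rightarrow>\<^sub>E A. f x) / card A ^ card I)\<^sup>2)
           \<le> card I * c\<^sup>2 * card A ^ card I"
  using assms(1,4)
proof (induction I arbitrary: f)
  case empty
  then show ?case by simp
next
  case (insert i I)
  define m where "m = real (card A)"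
  have m: "m > 0" using assms by (simp add: m_def card_gt_0_iff)
  define g where "g x = (\<Sum>a\<in>A. f (x(i := a))) / m" for x
  define \<mu> where "\<mu> = (\<Sum>x\<in>insert i I \<rightarrow>\<^sub>E A. f x) / m ^ card (insert i I)"
  have g_mean: "(\<Sum>x\<in>I \<rightarrow>\<^sub>E A. g x) / m ^ card I = \<mu>"
    using insert.hyps m
    by (simp add: g_def \<mu>_def sum_PiE_insert sum_divide_distrib[symmetric] sum.swap[of _ A])
  have upd: "x(i := a) \<in> insert i I \<rightarrow>\<^sub>E A" if "x \<in> I \<rightarrow>\<^sub>E A" "a \<in> A" for x a
    using that by (auto simp: PiE_insert_eq)
  have "\<bar>g (x(j := b)) - g x\<bar> \<le> c" if x: "x \<in> I \<rightarrow>\<^sub>E A" and j: "j \<in> I" and b: "b \<in> A" for x j b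
  proof -
    have "j \<noteq> i" using insert.hyps j by auto
    \<comment> \<open>Updates at different coordinates commute, so this is a redraw of
      \<open>j\<close> in \<open>x(i := a)\<close>. The \<open>- 0\<close> matches
      \<open>abs_average_diff_le\<close> with target 0.\<close>
    have "\<bar>f ((x(j := b))(i := a)) - f (x(i := a)) - 0\<bar> \<le> c" if "a \<in> A" for a
      using insert.prems[OF upd[OF x that], of j b] j b by (simp only: fun_upd_twist[OF \<open>j \<noteq> i\<close>] insertI2 diff_0_right)
    then have "\<bar>(\<Sum>a\<in>A. f ((x(j := b))(i := a)) - f (x(i := a))) / card A - 0\<bar> \<le> c"
      using assms by (intro abs_average_diff_le) auto
    then show ?thesis by (simp add: g_def m_def sum_subtractf diff_divide_distrib)
  qed
  from insert.IH[of g, OF this]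
  have IH: "(\<Sum>x\<in>I \<rightarrow>\<^sub>E A. (g x - \<mu>)\<^sup>2) \<le> card I * c\<^sup>2 * m ^ card I"
    using g_mean by (simp add: m_def)
  \<comment> \<open>All values on a fibre lie within \<open>c\<close> of each other, hence within
    \<open>c\<close> of their average.\<close>
  have fg: "\<bar>f (x(i := a)) - g x\<bar> \<le> c" if x: "x \<in> I \<rightarrow>\<^sub>E A" and a: "a \<in> A" for x a
  proof -
    have "\<bar>f (x(i := b)) - f (x(i := a))\<bar> \<le> c" if "b \<in> A" for b
      using insert.prems[OF upd[OF x a], of i b] that by (simp only: fun_upd_upd insertI1)
    then have "\<bar>g x - f (x(i := a))\<bar> \<le> c"
      unfolding g_def m_def using assms by (intro abs_average_diff_le) auto
    then show ?thesis by linarith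
  qed
  have "(\<Sum>x\<in>insert i I \<rightarrow>\<^sub>E A. (f x - \<mu>)\<^sup>2) = (\<Sum>x\<in>I \<rightarrow>\<^sub>E A. \<Sum>a\<in>A. (f (x(i := a)) - \<mu>)\<^sup>2)"
    using insert.hyps by (simp add: sum_PiE_insert sum.swap[of _ A])
  also have "\<dots> = (\<Sum>x\<in>I \<rightarrow>\<^sub>E A. (\<Sum>a\<in>A. (f (x(i := a)) - g x)\<^sup>2) + m * (g x - \<mu>)\<^sup>2)"
    unfolding g_def m_def by (intro sum.cong refl sum_square_deviation assms)
  also have "\<dots> \<le> (\<Sum>x\<in>I \<rightarrow>\<^sub>E A. (\<Sum>a\<in>A. c\<^sup>2) + m * (g x - \<mu>)\<^sup>2)"
  proof (intro sum_mono add_mono order.refl)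
    fix x a assume "x \<in> I \<rightarrow>\<^sub>E A" "a \<in> A"
    then show "(f (x(i := a)) - g x)\<^sup>2 \<le> c\<^sup>2"
      using power_mono[OF fg abs_ge_zero, of x a 2] by (simp only: power2_abs)
  qed
  also have "\<dots> = m * (c\<^sup>2 * m ^ card I + (\<Sum>x\<in>I \<rightarrow>\<^sub>E A. (g x - \<mu>)\<^sup>2))"
    using insert.hyps
    by (simp add: sum.distrib sum_distrib_left card_PiE m_def algebra_simps)
  also have "\<dots> \<le> m * (c\<^sup>2 * m ^ card I + card I * c\<^sup>2 * m ^ card I)"
    using IH m by simp
  also have "\<dots> = card (insert i I) * c\<^sup>2 * m ^ card (insert i I)"
    using insert.hyps by (simp add: algebra_simps)
  finally show ?case by (simp add: \<mu>_def m_def)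
qed

section \<open>Poisson weights and the binomial approximation\<close>

text \<open>The index is an integer, with weight 0 below zero, so that recursions involving
  \<open>j - 1\<close> hold without a special case at \<open>j = 0\<close>.\<close>

definition poisson_weight :: "int \<Rightarrow> real \<Rightarrow> real" where
  "poisson_weight j t = (if j < 0 then 0 else exp (- t) * t ^ nat j / fact (nat j))"

lemma poisson_weight_bounds:
  assumes "t \<ge> 0"
  shows "0 \<le> poisson_weight j t" "poisson_weight j t \<le> 1"
proof -
  have "t ^ n / fact n \<le> exp t" for n
  proof -
    have "(\<lambda>n. t ^ n / fact n) sums exp t"
      using exp_converges[of t] by (simp add: field_simps)
    then show ?thesis
      using sum_le_suminf[of "\<lambda>n. t ^ n / fact n" "{n}"] assms by (auto simp: sums_iff)
  qed
  from this[of "nat j"] show "poisson_weight j t \<le> 1"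
    by (simp add: poisson_weight_def exp_minus field_simps)
  show "0 \<le> poisson_weight j t"
    using assms by (simp add: poisson_weight_def)
qed

lemma has_derivative_poisson_weight:
  "(poisson_weight j has_real_derivative poisson_weight (j - 1) t - poisson_weight j t) (at t)"
proof (cases "j \<le> 0")
  case True
  then show ?thesis
    unfolding poisson_weight_def[abs_def]
    by (cases "j = 0") (auto intro!: derivative_eq_intros)
next
  case False
  then obtain n where j: "j = int (Suc n)"
    by (metis not_le zero_less_imp_eq_int Suc_pred)
  have "((\<lambda>t. exp (- t) * t ^ Suc n / fact (Suc n)) has_real_derivative
      (- exp (- t) * t ^ Suc n + exp (- t) * (real (Suc n) * t ^ n)) / fact (Suc n)) (at t)"
    by (auto intro!: derivative_eq_intros simp del: fact_Suc power_Suc)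
  moreover have "(- exp (- t) * t ^ Suc n + exp (- t) * (real (Suc n) * t ^ n)) / fact (Suc n)
      = exp (- t) * t ^ n / fact n - exp (- t) * t ^ Suc n / fact (Suc n)"
    by (simp add: diff_divide_distrib del: power_Suc of_nat_Suc)
  moreover have "nat (1 + int n) = Suc n" by simp
  ultimately show ?thesis
    by (simp add: j poisson_weight_def[abs_def] del: fact_Suc power_Suc)
qed

text \<open>The middle expression is the first-order Taylor polynomial at \<open>t\<close>, and it
  is also the effect of one extra trial with success probability \<open>p\<close>. Two applications
  of the mean value theorem reduce the error to the second derivative, a second difference of
  weights in [0,1], hence at most 2 in absolute value.\<close>

lemma poisson_weight_increment:
  assumes "t \<ge> 0" "p \<ge> 0"
  shows "\<bar>poisson_weight j (t + p) - ((1 - p) * poisson_weight j t + p * poisson_weight (j - 1) t)\<bar> \<le> 2 * p\<^sup>2"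
proof (cases "p = 0")
  case False
  then have p: "p > 0" using assms by simp
  let ?q = poisson_weight
  let ?d = "\<lambda>s. ?q (j - 1) s - ?q j s"
  let ?dd = "\<lambda>s. (?q (j - 1 - 1) s - ?q (j - 1) s) - ?d s"
  obtain s where s: "t < s" "s < t + p" "?q j (t + p) - ?q j t = (t + p - t) * ?d s"
    using MVT2[of t "t + p" "?q j" ?d] p has_derivative_poisson_weight by auto
  have "(?d has_real_derivative ?dd r) (at r)" for r
    by (intro DERIV_diff has_derivative_poisson_weight)
  then obtain r where r: "t < r" "r < s" "?d s - ?d t = (s - t) * ?dd r"
    using MVT2[of t s ?d ?dd] s(1) by blast
  have "r \<ge> 0" using r assms by simp
  then have "\<bar>?dd r\<bar> \<le> 2"
    using poisson_weight_bounds[of r j] poisson_weight_bounds[of r "j - 1"]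
      poisson_weight_bounds[of r "j - 1 - 1"] by linarith
  then have "\<bar>?d s - ?d t\<bar> \<le> p * 2"
    unfolding r(3) abs_mult using s by (intro mult_mono) auto
  moreover have "?q j (t + p) - ((1 - p) * ?q j t + p * ?q (j - 1) t) = p * (?d s - ?d t)"
    using s(3) by (simp add: algebra_simps)
  ultimately show ?thesis
    using p by (simp add: abs_mult power2_eq_square)
qed simp

text \<open>Induction on the trials, for all \<open>k\<close> at once since conditioning on the new
  draw leads to \<open>k - 1\<close> and \<open>k\<close>. A convex combination does not enlarge the
  error already present, and each trial adds the one-step error of
  \<open>poisson_weight_increment\<close>.\<close>

lemma binomial_poisson_approximation:
  fixes I :: "'i set" and A :: "'a set" and k :: int and p :: real
  assumes "finite I" "finite A" "A \<noteq> {}" "S \<subseteq> A"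
  defines "p \<equiv> real (card S) / card A"
  shows "\<bar>card {x \<in> I \<rightarrow>\<^sub>E A. int (card {j\<in>I. x j \<in> S}) = k} / card A ^ card I
            - poisson_weight k (card I * p)\<bar> \<le> 2 * card I * p\<^sup>2"
  using assms(1)
proof (induction I arbitrary: k)
  case empty
  then show ?case
    by (cases "k = 0") (auto simp: poisson_weight_def power_0_left)
next
  case (insert i I)
  define m where "m = real (card A)"
  have m: "m > 0" using assms by (simp add: m_def card_gt_0_iff)
  have p: "0 \<le> p" "p \<le> 1"
    using assms m by (auto simp: p_def m_def divide_le_eq intro: card_mono)
  define W where "W J k = real (card {x \<in> J \<rightarrow>\<^sub>E A. int (card {j\<in>J. x j \<in> S}) = k})" for J :: "'i set" and k
  have W_sum: "W J k = (\<Sum>x\<in>J \<rightarrow>\<^sub>E A. of_bool (int (card {j\<in>J. x j \<in> S}) = k))" if "finite J" for J k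
    using that assms by (simp add: W_def finite_PiE Int_def)
  have count: "int (card {j\<in>insert i I. (x(i := a)) j \<in> S}) = int (card {j\<in>I. x j \<in> S}) + of_bool (a \<in> S)" for x a
  proof -
    have "{j\<in>insert i I. (x(i := a)) j \<in> S} = (if a \<in> S then insert i {j\<in>I. x j \<in> S} else {j\<in>I. x j \<in> S})"
      using insert.hyps by auto
    then show ?thesis using insert.hyps by simp
  qed
  have "W (insert i I) k
      = (\<Sum>a\<in>A. \<Sum>x\<in>I \<rightarrow>\<^sub>E A. of_bool (int (card {j\<in>I. x j \<in> S}) + of_bool (a \<in> S) = k))"
    using insert.hyps by (simp only: W_sum finite_insert sum_PiE_insert[OF insert.hyps(2)] count)
  also have "\<dots> = (\<Sum>a\<in>A. if a \<in> S then W I (k - 1) else W I k)"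
    using insert.hyps by (intro sum.cong refl) (simp add: W_sum eq_diff_eq)
  also have "\<dots> = card S * W I (k - 1) + (card A - card S) * W I k"
    using assms by (simp add: sum.If_cases Int_absorb1 card_Diff_subset finite_subset Diff_eq[symmetric])
  also have "\<dots> = m * (p * W I (k - 1) + (1 - p) * W I k)"
    using assms m card_mono[OF assms(2,4)] by (simp add: p_def m_def field_simps of_nat_diff)
  finally have rec: "W (insert i I) k / m ^ card (insert i I)
      = p * (W I (k - 1) / m ^ card I) + (1 - p) * (W I k / m ^ card I)"
    using insert.hyps m by (simp add: field_simps)
  let ?e = "2 * card I * p\<^sup>2" and ?t = "card I * p"
  have *: "\<bar>p * (W I (k - 1) / m ^ card I - poisson_weight (k - 1) ?t)\<bar> \<le> p * ?e"
       "\<bar>(1 - p) * (W I k / m ^ card I - poisson_weight k ?t)\<bar> \<le> (1 - p) * ?e"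
    using insert.IH p unfolding W_def m_def abs_mult by (auto intro!: mult_mono)
  have incr: "\<bar>poisson_weight k (?t + p) - ((1 - p) * poisson_weight k ?t + p * poisson_weight (k - 1) ?t)\<bar> \<le> 2 * p\<^sup>2"
    using p by (intro poisson_weight_increment) auto
  have "\<bar>W (insert i I) k / m ^ card (insert i I) - poisson_weight k (?t + p)\<bar> \<le> ?e + 2 * p\<^sup>2"
  proof -
    \<comment> \<open>The new error is the convex combination of the two old errors minus the error
      of advancing the Poisson parameter by \<open>p\<close>.\<close>
    have "p * X + (1 - p) * Y - Q = p * (X - q') + (1 - p) * (Y - q) - (Q - ((1 - p) * q + p * q'))"
      for X Y Q q q' :: real by (simp add: algebra_simps)
    note split = this[of "W I (k - 1) / m ^ card I" "W I k / m ^ card I" "poisson_weight k (?t + p)"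
        "poisson_weight (k - 1) ?t" "poisson_weight k ?t"]
    have "p * ?e + (1 - p) * ?e = ?e" by (simp add: algebra_simps)
    with * incr show ?thesis
      unfolding rec split by linarith
  qed
  moreover have "?t + p = card (insert i I) * p" "?e + 2 * p\<^sup>2 = 2 * card (insert i I) * p\<^sup>2"
    using insert.hyps by (simp_all add: algebra_simps)
  ultimately show ?case
    unfolding W_def m_def by (simp only: of_nat_power)
qed

lemma card_Collect_diff_le:
  assumes "finite A" "finite T" "\<And>y. y \<in> A - T \<Longrightarrow> P y \<longleftrightarrow> Q y"
  shows "\<bar>real (card {y\<in>A. P y}) - real (card {y\<in>A. Q y})\<bar> \<le> card T"
proof -
  have "card {y\<in>A. P y} \<le> card ({y\<in>A. Q y} \<union> T)" "card {y\<in>A. Q y} \<le> card ({y\<in>A. P y} \<union> T)"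
    using assms by (auto intro!: card_mono)
  then show ?thesis
    using card_Un_le[of "{y\<in>A. Q y}" T] card_Un_le[of "{y\<in>A. P y}" T] by linarith
qed

text \<open>Limiting probability that a fixed point of \<open>\<psi>\<close> occurs exactly \<open>k\<close> times.\<close>
definition fixed_weight :: "nat \<Rightarrow> real" where
  "fixed_weight k = (if even k then poisson_weight (int (k div 2)) (1 / 2) else 0)"

section \<open>Symmetric vectors read off their first half\<close>

locale involution =
  fixes A :: "'a set" and \<psi> :: "'a \<Rightarrow> 'a" and n :: nat
  assumes finite_A: "finite A" and card_A: "card A = 2 * n" and n_pos: "n > 0"
    and closed: "y \<in> A \<Longrightarrow> \<psi> y \<in> A" and involutive: "y \<in> A \<Longrightarrow> \<psi> (\<psi> y) = y"
begin

lemma A_nonempty: "A \<noteq> {}"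
  using card_A n_pos by auto

text \<open>The reflection sending \<open>j\<close> to \<open>2 * n + 1 - j\<close> exchanges the
  two halves without fixed index, so the first half is free and determines the second. Involutivity
  makes the constraints at \<open>j\<close> and at its reflection agree.\<close>

lemma bij_betw_restrict_X_psi:
  "bij_betw (\<lambda>x. restrict x {1..n}) (X_psi A \<psi>) ({1..n} \<rightarrow>\<^sub>E A)"
proof (rule bij_betw_byWitness)
  let ?e = "\<lambda>z. \<lambda>j\<in>{1..2 * n}. if j \<le> n then z j else \<psi> (z (2 * n + 1 - j))"
  show "\<forall>x\<in>X_psi A \<psi>. ?e (restrict x {1..n}) = x"
  proof
    fix x assume "x \<in> X_psi A \<psi>"
    then have x: "x \<in> {1..2 * n} \<rightarrow>\<^sub>E A"
      and sym: "\<And>j. j \<in> {1..2 * n} \<Longrightarrow> x (2 * n + 1 - j) = \<psi> (x j)"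
      by (auto simp: X_psi_def card_A)
    show "?e (restrict x {1..n}) = x"
    proof
      fix j
      \<comment> \<open>For \<open>j > n\<close> within range, symmetry at the reflected index
        recovers \<open>x j\<close>; outside the range both sides are
        \<open>undefined\<close>.\<close>
      show "?e (restrict x {1..n}) j = x j"
        using x sym[of "2 * n + 1 - j"] by (auto simp: PiE_def extensional_def)
    qed
  qed
  show "\<forall>z\<in>{1..n} \<rightarrow>\<^sub>E A. restrict (?e z) {1..n} = z"
    by (auto simp: fun_eq_iff restrict_def PiE_def extensional_def)
  show "(\<lambda>x. restrict x {1..n}) ` X_psi A \<psi> \<subseteq> {1..n} \<rightarrow>\<^sub>E A"
    by (auto simp: X_psi_def card_A PiE_iff)
  show "?e ` ({1..n} \<rightarrow>\<^sub>E A) \<subseteq> X_psi A \<psi>"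
  proof (intro image_subsetI)
    fix z assume z: "z \<in> {1..n} \<rightarrow>\<^sub>E A"
    have zA: "z j \<in> A" if "1 \<le> j" "j \<le> n" for j using z that by auto
    have "?e z \<in> {1..2 * n} \<rightarrow>\<^sub>E A"
      using zA closed by auto
    moreover have "?e z (2 * n + 1 - j) = \<psi> (?e z j)" if j: "j \<in> {1..2 * n}" for j
    proof (cases "j \<le> n")
      case True
      then show ?thesis using j by auto
    next
      case False
      then have "z (2 * n + 1 - j) \<in> A" using j by (intro zA) auto
      then show ?thesis using j False involutive by auto
    qed
    ultimately show "?e z \<in> X_psi A \<psi>" by (simp add: X_psi_def card_A)
  qed
qed

text \<open>Multiplicity of \<open>y\<close> in the full vector, read off its first half \<open>z\<close>.\<close>
definition half_occ :: "'a \<Rightarrow> (nat \<Rightarrow> 'a) \<Rightarrow> nat" where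
  "half_occ y z = card {j\<in>{1..n}. z j = y} + card {j\<in>{1..n}. z j = \<psi> y}"

text \<open>An occurrence of \<open>y\<close> in the second half is the reflection of an occurrence
  of \<open>\<psi> y\<close> in the first.\<close>

lemma card_occurrences:
  assumes x: "x \<in> X_psi A \<psi>" and y: "y \<in> A"
  shows "card {j\<in>{1..2 * n}. x j = y} = half_occ y (restrict x {1..n})"
proof -
  have sym: "\<And>j. j \<in> {1..2 * n} \<Longrightarrow> x (2 * n + 1 - j) = \<psi> (x j)"
    using x by (auto simp: X_psi_def card_A)
  let ?r = "\<lambda>j. 2 * n + 1 - j"
  have "{j\<in>{1..2 * n}. x j = y} = {j\<in>{1..n}. x j = y} \<union> ?r ` {j\<in>{1..n}. x j = \<psi> y}" (is "?L = ?R")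
  proof (intro equalityI subsetI)
    fix j assume j: "j \<in> ?L"
    show "j \<in> ?R"
    proof (cases "j \<le> n")
      case False
      then have "j = ?r (?r j)" "?r j \<in> {j\<in>{1..n}. x j = \<psi> y}"
        using j sym[of j] by auto
      then show ?thesis by blast
    qed (use j in auto)
  next
    fix j assume "j \<in> ?R"
    then show "j \<in> ?L"
      using sym involutive[OF y] by auto
  qed
  moreover have "card (?r ` {j\<in>{1..n}. x j = \<psi> y}) = card {j\<in>{1..n}. x j = \<psi> y}"
    by (intro card_image inj_onI) auto
  moreover have "{j\<in>{1..n}. x j = y} \<inter> ?r ` {j\<in>{1..n}. x j = \<psi> y} = {}"
    by auto
  moreover have "{j\<in>{1..n}. restrict x {1..n} j = v} = {j\<in>{1..n}. x j = v}" for v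
    by auto
  ultimately show ?thesis
    by (simp add: half_occ_def card_Un_disjoint)
qed

section \<open>Local changes of the count and occurrence probabilities\<close>

definition half_count :: "nat \<Rightarrow> (nat \<Rightarrow> 'a) \<Rightarrow> real" where
  "half_count k z = card {y\<in>A. half_occ y z = k}"

lemma occ_count_eq_half_count:
  assumes "x \<in> X_psi A \<psi>"
  shows "real (occ_count A k x) = half_count k (restrict x {1..n})"
  using card_occurrences[OF assms]
  by (simp add: occ_count_def half_count_def card_A cong: conj_cong)

text \<open>The multiplicity of \<open>y\<close> depends only on where \<open>y\<close> and
  \<open>\<psi> y\<close> are drawn, so only the old and new values and their images under
  \<open>\<psi>\<close> can be affected. This supplies the constant 4 for
  \<open>bounded_differences_variance\<close>.\<close>

lemma half_count_update:
  assumes "z \<in> {1..n} \<rightarrow>\<^sub>E A" "i \<in> {1..n}" "a \<in> A"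
  shows "\<bar>half_count k (z(i := a)) - half_count k z\<bar> \<le> 4"
proof -
  let ?T = "{a, \<psi> a, z i, \<psi> (z i)}"
  have "half_occ y (z(i := a)) = half_occ y z" if y: "y \<in> A - ?T" for y
  proof -
    have "z i \<noteq> \<psi> y" "a \<noteq> \<psi> y" using y involutive by auto
    then have "{j\<in>{1..n}. (z(i := a)) j = v} = {j\<in>{1..n}. z j = v}" if "v \<in> {y, \<psi> y}" for v
      using y that by auto
    then show ?thesis by (simp add: half_occ_def del: fun_upd_apply)
  qed
  then have "\<bar>half_count k (z(i := a)) - half_count k z\<bar> \<le> card ?T"
    unfolding half_count_def by (intro card_Collect_diff_le finite_A) auto
  \<comment> \<open>The four points may coincide; the length of a list bounds the size of its set in
    any case.\<close>
  also have "card ?T \<le> 4"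
    using card_length[of "[a, \<psi> a, z i, \<psi> (z i)]"] by simp
  finally show ?thesis by simp
qed

text \<open>With \<open>M = card A\<close> and \<open>n = M / 2\<close>, a fixed point has
  \<open>p = 1 / M\<close>, Poisson parameter \<open>n * p = 1 / 2\<close> and error
  \<open>1 / M\<close>; both halves contribute equally, so odd \<open>k\<close> is impossible.
  Otherwise \<open>y\<close> and \<open>\<psi> y\<close> form a set of two points, giving
  \<open>p = 2 / M\<close>, parameter 1 and error \<open>4 / M\<close>.\<close>

lemma half_occ_probability:
  assumes y: "y \<in> A"
  shows "\<bar>card {z \<in> {1..n} \<rightarrow>\<^sub>E A. half_occ y z = k} / card A ^ n
     - (if \<psi> y = y then fixed_weight k else poisson_weight (int k) 1)\<bar> \<le> 4 / card A"
proof (cases "\<psi> y = y")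
  case True
  have half: "half_occ y z = 2 * card {j\<in>{1..n}. z j \<in> {y}}" for z
    by (simp add: half_occ_def True)
  show ?thesis
  proof (cases "even k")
    case False
    then have "{z \<in> {1..n} \<rightarrow>\<^sub>E A. half_occ y z = k} = {}"
      by (auto simp: half)
    then show ?thesis unfolding \<open>_ = {}\<close> using True False by (simp add: fixed_weight_def)
  next
    case even: True
    then have "{z \<in> {1..n} \<rightarrow>\<^sub>E A. half_occ y z = k}
        = {z \<in> {1..n} \<rightarrow>\<^sub>E A. int (card {j\<in>{1..n}. z j \<in> {y}}) = int (k div 2)}"
      unfolding half by auto
    then have "\<bar>card {z \<in> {1..n} \<rightarrow>\<^sub>E A. half_occ y z = k} / card A ^ n - fixed_weight k\<bar> \<le> 1 / card A"
      using binomial_poisson_approximation[of "{1..n}" A "{y}" "int (k div 2)"]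
        finite_A A_nonempty y even n_pos
      by (simp add: fixed_weight_def card_A power2_eq_square field_simps)
    also have "1 / real (card A) \<le> 4 / card A"
      by (intro divide_right_mono) auto
    finally show ?thesis using True by simp
  qed
next
  case False
  have "half_occ y z = card {j\<in>{1..n}. z j \<in> {y, \<psi> y}}" for z
  proof -
    have "{j\<in>{1..n}. z j \<in> {y, \<psi> y}} = {j\<in>{1..n}. z j = y} \<union> {j\<in>{1..n}. z j = \<psi> y}"
      by auto
    moreover have "{j\<in>{1..n}. z j = y} \<inter> {j\<in>{1..n}. z j = \<psi> y} = {}"
      using False by auto
    ultimately show ?thesis by (simp add: half_occ_def card_Un_disjoint)
  qed
  moreover have "card {y, \<psi> y} = 2" using False by auto
  ultimately show ?thesis
    using binomial_poisson_approximation[of "{1..n}" A "{y, \<psi> y}" "int k"]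
      finite_A A_nonempty y closed False n_pos
    by (simp add: card_A power2_eq_square field_simps)
qed

section \<open>Mean, second moment and Chebyshev's inequality\<close>

text \<open>The mixture uses the actual proportion of fixed points; its distance from the mixture
  with weight \<theta> is estimated only in the theorem.\<close>

definition limit_density :: "nat \<Rightarrow> real" where
  "limit_density k = (1 - card (fixed_points A \<psi>) / card A) * poisson_weight (int k) 1
     + card (fixed_points A \<psi>) / card A * fixed_weight k"

text \<open>Linearity of expectation: each of the \<open>card A\<close> points contributes an error
  of at most \<open>4 / card A\<close>.\<close>

lemma mean_half_count:
  "\<bar>(\<Sum>z\<in>{1..n} \<rightarrow>\<^sub>E A. half_count k z) / card A ^ n - card A * limit_density k\<bar> \<le> 4"
proof -
  let ?\<Omega> = "{1..n} \<rightarrow>\<^sub>E A" and ?F = "fixed_points A \<psi>"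
  let ?w = "\<lambda>y. if \<psi> y = y then fixed_weight k else poisson_weight (int k) 1"
  let ?W = "\<lambda>y. card {z \<in> ?\<Omega>. half_occ y z = k} / real (card A ^ n)"
  have fin: "finite ?\<Omega>" by (intro finite_PiE) (auto simp: finite_A)
  have M: "real (card A) > 0" using card_A n_pos by simp
  have F: "?F \<subseteq> A" by (auto simp: fixed_points_def)
  have "(\<Sum>z\<in>?\<Omega>. half_count k z) = (\<Sum>z\<in>?\<Omega>. \<Sum>y\<in>A. of_bool (half_occ y z = k))"
    using finite_A by (simp add: half_count_def Int_def)
  also have "\<dots> = (\<Sum>y\<in>A. \<Sum>z\<in>?\<Omega>. of_bool (half_occ y z = k))"
    by (rule sum.swap)
  also have "\<dots> = (\<Sum>y\<in>A. real (card {z \<in> ?\<Omega>. half_occ y z = k}))"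
    using fin by (simp add: Int_def)
  finally have W: "(\<Sum>z\<in>?\<Omega>. half_count k z) / card A ^ n = (\<Sum>y\<in>A. ?W y)"
    by (simp add: sum_divide_distrib)
  have "(\<Sum>y\<in>A. ?w y) = (\<Sum>y\<in>A - ?F. ?w y) + (\<Sum>y\<in>?F. ?w y)"
    by (rule sum.subset_diff[OF F finite_A])
  also have "(\<Sum>y\<in>A - ?F. ?w y) = (\<Sum>y\<in>A - ?F. poisson_weight (int k) 1)"
    by (intro sum.cong) (auto simp: fixed_points_def)
  also have "(\<Sum>y\<in>?F. ?w y) = (\<Sum>y\<in>?F. fixed_weight k)"
    by (intro sum.cong) (auto simp: fixed_points_def)
  also have "(\<Sum>y\<in>A - ?F. poisson_weight (int k) 1) + (\<Sum>y\<in>?F. fixed_weight k)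
      = card ?F * fixed_weight k + card (A - ?F) * poisson_weight (int k) 1"
    by simp
  also have "\<dots> = card A * limit_density k"
    using F finite_A A_nonempty card_mono[OF finite_A F]
    by (simp add: card_Diff_subset finite_subset of_nat_diff limit_density_def field_simps)
  finally have w: "(\<Sum>y\<in>A. ?w y) = card A * limit_density k" .
  have "\<bar>(\<Sum>y\<in>A. ?W y - ?w y) / card A - 0\<bar> \<le> 4 / card A"
    using half_occ_probability finite_A A_nonempty by (intro abs_average_diff_le) auto
  then have "\<bar>\<Sum>y\<in>A. ?W y - ?w y\<bar> \<le> 4"
    using M by (simp add: divide_le_cancel)
  then show ?thesis
    using W w by (simp add: sum_subtractf)
qed

text \<open>Variance plus squared bias, after division by \<open>card A\<close>. The variance
  \<open>16 * n\<close> of the count becomes \<open>8 / card A\<close> because \<open>n\<close> is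
  half of \<open>card A\<close>; the bias combines the error of the mean with the distance from
  \<open>limit_density k\<close> to \<open>L\<close>.\<close>

lemma second_moment_occ_count:
  "(\<Sum>x\<in>X_psi A \<psi>. (occ_count A k x / card A - L)\<^sup>2)
     \<le> card (X_psi A \<psi>) * (8 / card A + (4 / card A + \<bar>limit_density k - L\<bar>)\<^sup>2)"
proof -
  let ?\<Omega> = "{1..n} \<rightarrow>\<^sub>E A"
  define M where "M = real (card A)"
  define N where "N = real (card ?\<Omega>)"
  have M: "M > 0" "real n = M / 2" using card_A n_pos by (auto simp: M_def)
  have N: "N = M ^ n" by (simp add: N_def M_def card_PiE)
  have N_pos: "N > 0" using M N by simp
  have fin: "finite ?\<Omega>" "?\<Omega> \<noteq> {}"
    using A_nonempty by (auto simp: finite_A PiE_eq_empty_iff intro!: finite_PiE)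
  have card_X: "real (card (X_psi A \<psi>)) = N"
    using bij_betw_same_card[OF bij_betw_restrict_X_psi] by (simp add: N_def)
  define \<mu> where "\<mu> = (\<Sum>z\<in>?\<Omega>. half_count k z) / N"
  have \<mu>: "\<bar>\<mu> - M * limit_density k\<bar> \<le> 4"
    using mean_half_count[of k] by (simp add: \<mu>_def N M_def)
  have var: "(\<Sum>z\<in>?\<Omega>. (half_count k z - \<mu>)\<^sup>2) \<le> n * 4\<^sup>2 * N"
    using bounded_differences_variance[of "{1..n}" A "half_count k" 4]
      half_count_update finite_A A_nonempty
    by (simp add: \<mu>_def N M_def)
  have "\<bar>\<mu> - M * L\<bar> \<le> 4 + M * \<bar>limit_density k - L\<bar>"
  proof -
    have "\<mu> - M * L = (\<mu> - M * limit_density k) + M * (limit_density k - L)"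
      by (simp add: algebra_simps)
    then show ?thesis
      using \<mu> M abs_triangle_ineq[of "\<mu> - M * limit_density k" "M * (limit_density k - L)"]
      by (simp add: abs_mult)
  qed
  then have bias: "(\<mu> - M * L)\<^sup>2 \<le> (4 + M * \<bar>limit_density k - L\<bar>)\<^sup>2"
    by (metis abs_ge_zero power2_abs power_mono)
  have "(\<Sum>x\<in>X_psi A \<psi>. (occ_count A k x / card A - L)\<^sup>2)
      = (\<Sum>x\<in>X_psi A \<psi>. (half_count k (restrict x {1..n}) / M - L)\<^sup>2)"
    by (intro sum.cong refl) (simp add: occ_count_eq_half_count M_def)
  also have "\<dots> = (\<Sum>z\<in>?\<Omega>. (half_count k z / M - L)\<^sup>2)"
    by (rule sum.reindex_bij_betw[OF bij_betw_restrict_X_psi])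
  also have "\<dots> = (\<Sum>z\<in>?\<Omega>. (half_count k z - M * L)\<^sup>2) / M\<^sup>2"
    unfolding sum_divide_distrib using M
    by (intro sum.cong refl) (simp add: power_divide[symmetric] diff_divide_distrib)
  also have "\<dots> = ((\<Sum>z\<in>?\<Omega>. (half_count k z - \<mu>)\<^sup>2) + N * (\<mu> - M * L)\<^sup>2) / M\<^sup>2"
    using sum_square_deviation[OF fin, of "half_count k" "M * L"] by (simp add: \<mu>_def N_def)
  also have "\<dots> \<le> (n * 4\<^sup>2 * N + N * (4 + M * \<bar>limit_density k - L\<bar>)\<^sup>2) / M\<^sup>2"
    using var bias N_pos by (intro divide_right_mono add_mono mult_left_mono) auto
  also have "\<dots> = N * (8 / M + ((4 + M * \<bar>limit_density k - L\<bar>) / M)\<^sup>2)"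
    using M by (simp add: power_divide add_divide_distrib power2_eq_square) (simp add: field_simps)
  also have "(4 + M * \<bar>limit_density k - L\<bar>) / M = 4 / M + \<bar>limit_density k - L\<bar>"
    using M by (simp add: add_divide_distrib)
  finally show ?thesis by (simp add: card_X M_def)
qed

lemma concentration_occ_count:
  assumes "d > 0"
  shows "card {x \<in> X_psi A \<psi>. \<bar>occ_count A k x / card A - L\<bar> < d} / card (X_psi A \<psi>)
     \<ge> 1 - (8 / card A + (4 / card A + \<bar>limit_density k - L\<bar>)\<^sup>2) / d\<^sup>2"
proof -
  let ?X = "X_psi A \<psi>" and ?h = "\<lambda>x. real (occ_count A k x) / card A - L"
  let ?G = "{x\<in>?X. \<bar>?h x\<bar> < d}"
  let ?V = "8 / card A + (4 / card A + \<bar>limit_density k - L\<bar>)\<^sup>2"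
  have "card ?X = card ({1..n} \<rightarrow>\<^sub>E A)"
    using bij_betw_same_card[OF bij_betw_restrict_X_psi] .
  then have pos: "card ?X > 0"
    using card_A n_pos by (simp add: card_PiE)
  then have fin: "finite ?X" using card_gt_0_iff by blast
  \<comment> \<open>Chebyshev's inequality: each exceptional vector contributes at least the square
    of \<open>d\<close> to the second moment about \<open>L\<close>.\<close>
  have "card (?X - ?G) * d\<^sup>2 = (\<Sum>x\<in>?X - ?G. d\<^sup>2)" by simp
  also have "\<dots> \<le> (\<Sum>x\<in>?X - ?G. (?h x)\<^sup>2)"
    using assms by (intro sum_mono) (auto simp: not_less abs_le_square_iff[symmetric])
  also have "\<dots> \<le> (\<Sum>x\<in>?X. (?h x)\<^sup>2)"
    using fin by (intro sum_mono2) auto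
  also have "\<dots> \<le> card ?X * ?V"
    by (rule second_moment_occ_count)
  finally have "card (?X - ?G) * d\<^sup>2 \<le> card ?X * ?V" .
  moreover have "real (card (?X - ?G)) = real (card ?X) - real (card ?G)"
    using fin by (subst card_Diff_subset) (auto intro!: of_nat_diff card_mono)
  ultimately have *: "(real (card ?X) - card ?G) * d\<^sup>2 \<le> card ?X * ?V" by simp
  have "(real (card ?X) - card ?G) / card ?X \<le> ?V / d\<^sup>2"
  proof (subst pos_divide_le_eq)
    show "real (card ?X) - card ?G \<le> ?V / d\<^sup>2 * card ?X"
      using * assms by (simp add: pos_le_divide_eq mult.commute)
  qed (use pos in simp)
  then show ?thesis
    using pos by (simp add: diff_divide_distrib)
qed

end

section \<open>Rates as M tends to infinity\<close>

theorem theorem4: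
  fixes \<theta> \<eta> \<delta> :: real
    and A :: "nat \<Rightarrow> 'a set"
    and \<psi> :: "nat \<Rightarrow> 'a \<Rightarrow> 'a"
    and \<epsilon> :: "nat \<Rightarrow> real"
  assumes "0 \<le> \<theta>" "\<theta> \<le> 1"
    and "0 \<le> \<eta>" "\<eta> < 1"
    and "0 < \<delta>" "2 * \<delta> + \<eta> < 1"
    and "\<And>M. even M \<Longrightarrow> M > 0 \<Longrightarrow> finite (A M) \<and> card (A M) = M"
    and "\<And>M. even M \<Longrightarrow> M > 0 \<Longrightarrow> bij_betw (\<psi> M) (A M) (A M)"
    and "\<And>M y. even M \<Longrightarrow> M > 0 \<Longrightarrow> y \<in> A M \<Longrightarrow> \<psi> M (\<psi> M y) = y"
    and "\<epsilon> \<in> O(\<lambda>M. real M powr (\<eta> - 1))"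
    and "\<forall>\<^sub>F M in sequentially. even M \<longrightarrow>
           real (card (fixed_points (A M) (\<psi> M))) = \<theta> * real M * (1 + \<epsilon> M)"
  shows "(\<exists>C. \<forall>\<^sub>F M in sequentially. even M \<longrightarrow> (\<forall>k. odd k \<longrightarrow>
            real (card {x \<in> X_psi (A M) (\<psi> M).
                \<bar>real (occ_count (A M) k x) / real M - (1 - \<theta>) / (exp 1 * fact k)\<bar>
                  < real M powr (- \<delta>)})
              / real (card (X_psi (A M) (\<psi> M)))
            \<ge> 1 - C * (real M powr (2 * \<delta> + \<eta> - 1) + (real k)\<^sup>2 * real M powr (2 * \<delta> - 1))))
       \<and> (\<exists>C. \<forall>\<^sub>F M in sequentially. even M \<longrightarrow> (\<forall>k. even k \<longrightarrow>
            real (card {x \<in> X_psi (A M) (\<psi> M).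
                \<bar>real (occ_count (A M) k x) / real M - (1 - \<theta>) / (exp 1 * fact k)
                   - \<theta> / (exp (1 / 2) * 2 ^ (k div 2) * fact (k div 2))\<bar>
                  < real M powr (- \<delta>)})
              / real (card (X_psi (A M) (\<psi> M)))
            \<ge> 1 - C * (real M powr (2 * \<delta> + \<eta> - 1) + (real k)\<^sup>2 * real M powr (2 * \<delta> - 1))))"
proof -
  define L where "L k = (1 - \<theta>) * poisson_weight (int k) 1 + \<theta> * fixed_weight k" for k
  obtain K where K: "K > 0"
    and \<epsilon>: "\<forall>\<^sub>F M in sequentially. norm (\<epsilon> M) \<le> K * norm (real M powr (\<eta> - 1))"
    using landau_o.bigE[OF assms(10)] by blast
  \<comment> \<open>The 8 absorbs the variance and \<open>(4 + K)\<^sup>2\<close> the squared bias,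
    both measured in units of \<open>M powr (\<eta> - 1)\<close>. One constant serves both parities
    and all \<open>k\<close>.\<close>
  define C where "C = 8 + (4 + K)\<^sup>2"
  define prob where "prob M k =
      real (card {x \<in> X_psi (A M) (\<psi> M). \<bar>real (occ_count (A M) k x) / real M - L k\<bar> < real M powr (- \<delta>)})
        / real (card (X_psi (A M) (\<psi> M)))" for M k
  define err where "err M k = real M powr (2 * \<delta> + \<eta> - 1) + (real k)\<^sup>2 * real M powr (2 * \<delta> - 1)" for M k :: nat
  have bound: "prob M k \<ge> 1 - C * err M k"
    if "norm (\<epsilon> M) \<le> K * norm (real M powr (\<eta> - 1))" "M > 0" "even M"
      "even M \<longrightarrow> real (card (fixed_points (A M) (\<psi> M))) = \<theta> * real M * (1 + \<epsilon> M)" for M k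
  proof -
    have "finite (A M)" and card_AM: "card (A M) = M"
      and F: "real (card (fixed_points (A M) (\<psi> M))) = \<theta> * real M * (1 + \<epsilon> M)"
      using that assms(7) by auto
    then interpret involution "A M" "\<psi> M" "M div 2"
      using that assms(8)[of M] assms(9)[of M]
      by unfold_locales (auto simp: bij_betw_apply)
    define e where "e = real M powr (\<eta> - 1)"
    have M: "real M \<ge> 1" using that by simp
    \<comment> \<open>The lower bound uses \<eta> \<ge> 0 and lets \<open>e\<close> absorb every
      \<open>1 / M\<close>; the upper bound uses \<eta> < 1 and lets the square of \<open>e\<close>
      be replaced by \<open>e\<close>.\<close>
    have e: "1 / real M \<le> e" "e \<le> 1" "e > 0"
      using powr_mono[of "-1" "\<eta> - 1" "real M"] powr_mono[of "\<eta> - 1" 0 "real M"] M assms(3,4)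
      by (auto simp: e_def powr_minus_divide)
    \<comment> \<open>The proportion of fixed points is
      \<open>\<theta> * (1 + \<epsilon> M)\<close>, so only the shift
      \<open>\<theta> * \<epsilon> M\<close> of the mixing weight survives.\<close>
    have "limit_density k - L k = - (\<theta> * \<epsilon> M * (poisson_weight (int k) 1 - fixed_weight k))"
      using F M by (simp add: limit_density_def L_def card_AM field_simps)
    then have "\<bar>limit_density k - L k\<bar> = \<theta> * \<bar>\<epsilon> M\<bar> * \<bar>poisson_weight (int k) 1 - fixed_weight k\<bar>"
      using assms(1) by (simp add: abs_mult)
    also have "\<dots> \<le> 1 * (K * e) * 1"
    proof (intro mult_mono)
      show "\<bar>\<epsilon> M\<bar> \<le> K * e" using that by (simp add: e_def)
      show "\<bar>poisson_weight (int k) 1 - fixed_weight k\<bar> \<le> 1"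
        using poisson_weight_bounds[of 1 "int k"] poisson_weight_bounds[of "1/2" "int (k div 2)"]
        by (auto simp: fixed_weight_def abs_le_iff)
    qed (use assms(1,2) K e in auto)
    finally have "4 / real M + \<bar>limit_density k - L k\<bar> \<le> (4 + K) * e"
      using e(1) by (simp add: algebra_simps)
    then have "(4 / real M + \<bar>limit_density k - L k\<bar>)\<^sup>2 \<le> ((4 + K) * e)\<^sup>2"
      by (intro power_mono) auto
    also have "\<dots> \<le> (4 + K)\<^sup>2 * e"
      using e mult_left_mono[of "e * e" e "(4 + K)\<^sup>2"] by (simp add: power2_eq_square mult_ac)
    finally have "8 / real M + (4 / real M + \<bar>limit_density k - L k\<bar>)\<^sup>2 \<le> C * e"
      using e(1) by (simp add: C_def algebra_simps)
    then have "(8 / real M + (4 / real M + \<bar>limit_density k - L k\<bar>)\<^sup>2) / (real M powr (- \<delta>))\<^sup>2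
        \<le> C * e / (real M powr (- \<delta>))\<^sup>2"
      by (intro divide_right_mono) auto
    also have "\<dots> = C * real M powr (2 * \<delta> + \<eta> - 1)"
    proof -
      have "(real M powr (- \<delta>))\<^sup>2 = real M powr (- (2 * \<delta>))"
        by (simp add: power2_eq_square flip: powr_add)
      moreover have "\<eta> - 1 - - (2 * \<delta>) = 2 * \<delta> + \<eta> - 1" by simp
      ultimately show ?thesis
        unfolding e_def by (metis powr_diff times_divide_eq_right)
    qed
    \<comment> \<open>The other summand of \<open>err M k\<close> is nonnegative.\<close>
    also have "\<dots> \<le> C * err M k"
      unfolding err_def by (intro mult_left_mono) (auto simp: C_def)
    finally show ?thesis
      using concentration_occ_count[of "real M powr (- \<delta>)" k "L k"] M by (simp add: card_AM prob_def)
  qed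
  \<comment> \<open>The conditions on \<open>M\<close> in \<open>bound\<close> do not mention
    \<open>k\<close>, so one threshold for \<open>M\<close> works for all \<open>k\<close>.\<close>
  have main: "\<forall>\<^sub>F M in sequentially. even M \<longrightarrow> (\<forall>k. prob M k \<ge> 1 - C * err M k)"
    using \<epsilon> assms(11) eventually_gt_at_top[of 0] by eventually_elim (use bound in blast)
  have odd: "L k = (1 - \<theta>) / (exp 1 * fact k)" if "odd k" for k
    using that by (simp add: L_def fixed_weight_def poisson_weight_def exp_minus field_simps)
  \<comment> \<open>Stated with a leading \<open>t\<close> so that rewriting produces the nested
    subtraction of the claim.\<close>
  have even: "t - L k = t - (1 - \<theta>) / (exp 1 * fact k)
      - \<theta> / (exp (1 / 2) * 2 ^ (k div 2) * fact (k div 2))" if "even k" for k t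
    using that
    by (simp add: L_def fixed_weight_def poisson_weight_def exp_minus power_one_over field_simps)
  have prob_odd: "prob M k = real (card {x \<in> X_psi (A M) (\<psi> M).
        \<bar>real (occ_count (A M) k x) / real M - (1 - \<theta>) / (exp 1 * fact k)\<bar> < real M powr (- \<delta>)})
      / real (card (X_psi (A M) (\<psi> M)))" if "odd k" for M k
    unfolding prob_def odd[OF that] ..
  have prob_even: "prob M k = real (card {x \<in> X_psi (A M) (\<psi> M).
        \<bar>real (occ_count (A M) k x) / real M - (1 - \<theta>) / (exp 1 * fact k)
           - \<theta> / (exp (1 / 2) * 2 ^ (k div 2) * fact (k div 2))\<bar> < real M powr (- \<delta>)})
      / real (card (X_psi (A M) (\<psi> M)))" if "even k" for M k
    unfolding prob_def even[OF that] ..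
  show ?thesis
  proof ((intro conjI exI[of _ C]; rule eventually_mono[OF main]; intro impI allI), goal_cases)
    case (1 M k)
    then have "prob M k \<ge> 1 - C * err M k" by blast
    then show ?case unfolding prob_odd[OF 1(3)] err_def .
  next
    case (2 M k)
    then have "prob M k \<ge> 1 - C * err M k" by blast
    then show ?case unfolding prob_even[OF 2(3)] err_def .
  qed
qed

end
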